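(* Let $r$ and $t$ be natural numbers and for fixed $t$ put $m_t=2^t$, $q_t=2^{t-1}-1$. (a) For $(m,q)=(m_t+1,q_t)$, $(m_t+1,q_t-1)$ or $(m_t,q_t-1)$ we have $$\binom{2^r m}{2^r q} \equiv 0 \pmod {2^{t-1}} \qquad \text{and} \qquad \binom{2^r m}{2^r q} \equiv \binom{m}{q} \pmod {2^{t}}.$$ (b) Moreover, $$\binom{2^r m_t}{2^r q_t} \equiv 0 \pmod{2^{t}} \qquad \text{and} \qquad \binom{2^r m_t}{2^r q_t} \equiv \binom{m_t}{q_t} \pmod{2^{t+1}}.$$
   Context: Natural numbers are the positive integers $1,2,3,\ldots$; $\binom{a}{b}$ denotes the usual binomial coefficient.
   Formalization: The first congruence of (a) is claimed only for t ≠ 2 and the first congruence of (b) only for t ≠ 1, since they fail there (e.g. C(10,2)=45 is odd; C(2^r·2,0)=1); binomials with negative lower index (t = 1) are taken as 0. *)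

theory Defs
  imports "HOL-Number_Theory.Cong"
begin

text \<open>
  The lower index is an integer because \<open>q_seq t - 1\<close> equals \<open>-1\<close> for \<open>t = 1\<close>; by the usual
  convention a binomial coefficient with negative lower index is zero, whereas truncated
  subtraction on \<^typ>\<open>nat\<close> would turn that index into \<open>0\<close>.
\<close>
definition binom :: "nat \<Rightarrow> int \<Rightarrow> nat" where
  "binom a b = (if b < 0 then 0 else a choose nat b)"

definition m_seq :: "nat \<Rightarrow> nat" where
  "m_seq t = 2 ^ t"

text \<open>The exponent is truncated at \<open>t = 0\<close>; only \<open>t \<ge> 1\<close> is meaningful.\<close>
definition q_seq :: "nat \<Rightarrow> int" where
  "q_seq t = 2 ^ (t - 1) - 1"

end

theory Submission imports Defs begin

text \<open>
  Separating the odd factors in \<open>(2n)!\<close> gives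
  \<open>(2m choose 2q) * O q * O (m - q) = (m choose q) * O m\<close>, where \<open>O n\<close> is the product of the
  first \<open>n\<close> odd numbers. The factors \<open>O\<close> are units modulo powers of 2 and agree modulo 2, so doubling
  both indices preserves \<open>m choose q\<close> modulo \<open>2 ^ (s + 1)\<close> whenever \<open>2 ^ s\<close> divides it. This
  iterates, and leaves only the divisibility of \<open>m choose q\<close> itself, which comes from
  \<open>k * (2 ^ t choose k) = 2 ^ t * (2 ^ t - 1 choose k - 1)\<close> and Pascal's rule.
  The exceptional odd value \<open>5 choose 1\<close> at \<open>t = 2\<close> needs congruence of the odd
  factors modulo 4, which holds because \<open>m - q\<close> is even.
\<close>

definition odd_prod :: "nat \<Rightarrow> nat" where
  "odd_prod n = (\<Prod>i<n. 2 * i + 1)"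

lemma odd_prod_0 [simp]: "odd_prod 0 = 1"
  by (simp add: odd_prod_def)

lemma odd_prod_Suc: "odd_prod (Suc n) = odd_prod n * (2 * n + 1)"
  by (simp add: odd_prod_def)

lemma odd_odd_prod: "odd (odd_prod n)"
  by (induction n) (simp_all add: odd_prod_Suc)

lemma fact_double: "fact (2 * n) = 2 ^ n * fact n * odd_prod n"
  by (induction n) (simp_all add: odd_prod_Suc algebra_simps)

lemma choose_double:
  "((2 * (a + b)) choose (2 * a)) * (odd_prod a * odd_prod b) = ((a + b) choose a) * odd_prod (a + b)"
proof -
  have big: "fact (2 * a) * fact (2 * b) * ((2 * (a + b)) choose (2 * a)) = (fact (2 * (a + b)) :: nat)"
    using binomial_fact_lemma[of "2 * a" "2 * (a + b)"] by simp
  have small: "fact a * fact b * ((a + b) choose a) = (fact (a + b) :: nat)"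
    using binomial_fact_lemma[of a "a + b"] by simp
  have "(2 ^ (a + b) * fact a * fact b) *
      (((2 * (a + b)) choose (2 * a)) * (odd_prod a * odd_prod b)) = fact (2 * (a + b))"
    unfolding big[symmetric] fact_double[of a] fact_double[of b] power_add by (simp only: ac_simps)
  also have "\<dots> = (2 ^ (a + b) * fact a * fact b) * (((a + b) choose a) * odd_prod (a + b))"
    unfolding fact_double[of "a + b"] small[symmetric] by (simp only: ac_simps)
  finally show ?thesis
    by simp
qed

lemma odd_prod_add_cong_2: "[odd_prod (a + b) = odd_prod a * odd_prod b] (mod 2)"
  using odd_odd_prod[of "a + b"] odd_odd_prod[of a] odd_odd_prod[of b]
  by (metis cong_def even_mult_iff odd_iff_mod_2_eq_one)

text \<open>Two consecutive odd factors multiply to \<open>4 * n * n + 8 * n + 3\<close>.\<close>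

lemma odd_prod_add_2_cong_4: "[odd_prod (n + 2) = 3 * odd_prod n] (mod 4)"
proof -
  have "odd_prod (n + 2) = 3 * odd_prod n + 4 * (odd_prod n * (n * n + 2 * n))"
    unfolding add_2_eq_Suc' odd_prod_Suc by (simp add: algebra_simps)
  then show ?thesis
    by (simp add: cong_def)
qed

text \<open>Grouping the last \<open>2 * k\<close> factors in pairs, each pair contributes 3 modulo
  4 wherever it starts. Evenness matters: \<open>odd_prod 2 = 3\<close>, while
  \<open>odd_prod 1 * odd_prod 1 = 1\<close>.\<close>

lemma odd_prod_add_cong_4: "[odd_prod (a + 2 * k) = odd_prod a * odd_prod (2 * k)] (mod 4)"
proof (induction k)
  case (Suc k)
  have "[odd_prod (a + 2 * k + 2) = 3 * (odd_prod a * odd_prod (2 * k))] (mod 4)"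
    using odd_prod_add_2_cong_4 cong_scalar_left[OF Suc.IH] by (rule cong_trans)
  moreover have "[odd_prod a * odd_prod (2 * k + 2) = odd_prod a * (3 * odd_prod (2 * k))] (mod 4)"
    using odd_prod_add_2_cong_4 by (rule cong_scalar_left)
  ultimately show ?case
    by (simp add: cong_def ac_simps)
qed simp

text \<open>The factor \<open>2 ^ s\<close> of the binomial coefficient lifts the congruence from
  modulus \<open>2 ^ e\<close> to \<open>2 ^ (s + e)\<close>; the odd products then cancel.\<close>

lemma choose_double_cong:
  assumes "2 ^ s dvd ((a + b) choose a)"
    and "[odd_prod (a + b) = odd_prod a * odd_prod b] (mod 2 ^ e)"
  shows "[(2 * (a + b)) choose (2 * a) = (a + b) choose a] (mod 2 ^ (s + e))"
proof -
  obtain c where c: "(a + b) choose a = 2 ^ s * c"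
    using assms(1) by (elim dvdE)
  have "[2 ^ s * (c * odd_prod (a + b)) = 2 ^ s * (c * (odd_prod a * odd_prod b))] (mod 2 ^ s * 2 ^ e)"
    using cong_scalar_left[OF assms(2), of c] by (simp only: cong_def mult_mod_right[symmetric])
  then have "[((2 * (a + b)) choose (2 * a)) * (odd_prod a * odd_prod b) =
      ((a + b) choose a) * (odd_prod a * odd_prod b)] (mod 2 ^ (s + e))"
    by (simp only: choose_double c power_add mult.assoc)
  then show ?thesis
    using odd_odd_prod by (simp add: cong_mult_rcancel_nat)
qed

lemma power2_dvd_if_cong_Suc:
  fixes x y :: nat
  assumes "[x = y] (mod 2 ^ (s + 1))" and "2 ^ s dvd y"
  shows "2 ^ s dvd x"
proof -
  have "[x = y] (mod 2 ^ s)"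
    using assms(1) by (rule cong_dvd_modulus_nat) simp
  then show ?thesis
    using assms(2) by (simp add: cong_dvd_iff[of x y])
qed

text \<open>Each doubling uses \<open>e = 1\<close>. The congruence reached so far carries
  divisibility by \<open>2 ^ s\<close> to the current coefficient, so the next doubling is
  possible.\<close>

lemma choose_power2_mult_cong:
  fixes m q :: nat
  assumes "q \<le> m" and "2 ^ s dvd (m choose q)"
  shows "[(2 ^ r * m) choose (2 ^ r * q) = m choose q] (mod 2 ^ (s + 1))"
proof (induction r)
  case (Suc r)
  let ?a = "2 ^ r * q" and ?b = "2 ^ r * (m - q)"
  have ab: "?a + ?b = 2 ^ r * m"
    using assms(1) by (simp add: algebra_simps)
  have "2 ^ s dvd ((2 ^ r * m) choose ?a)"
    using Suc.IH assms(2) by (rule power2_dvd_if_cong_Suc)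
  then have "[(2 * (?a + ?b)) choose (2 * ?a) = (?a + ?b) choose ?a] (mod 2 ^ (s + 1))"
    using odd_prod_add_cong_2[of ?a ?b] by (intro choose_double_cong) (simp_all only: ab power_one_right)
  then show ?case
    using Suc.IH unfolding ab power_Suc mult.assoc by (rule cong_trans)
qed simp

lemma choose_power2_mult_dvd:
  fixes m q :: nat
  assumes "q \<le> m" and "2 ^ s dvd (m choose q)"
  shows "2 ^ s dvd ((2 ^ r * m) choose (2 ^ r * q))"
  using choose_power2_mult_cong[OF assms] assms(2) by (rule power2_dvd_if_cong_Suc)

lemma choose_five_cong: "[(2 ^ r * 5) choose (2 ^ r) = 5] (mod 4)"
proof (induction r)
  case (Suc r)
  have "[odd_prod (2 ^ r + 4 * 2 ^ r) = odd_prod (2 ^ r) * odd_prod (4 * 2 ^ r)] (mod 4)"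
    using odd_prod_add_cong_4[of "2 ^ r" "2 * 2 ^ r"] by simp
  then have "[(2 * (2 ^ r + 4 * 2 ^ r)) choose (2 * 2 ^ r) = (2 ^ r + 4 * 2 ^ r) choose 2 ^ r] (mod 4)"
    using choose_double_cong[of 0 "2 ^ r" "4 * 2 ^ r" 2] by simp
  then have "[(2 ^ Suc r * 5) choose (2 ^ Suc r) = (2 ^ r * 5) choose 2 ^ r] (mod 4)"
    by (simp add: ac_simps)
  then show ?case
    using Suc.IH by (rule cong_trans)
qed simp

lemma power2_dvd_choose_mult: "2 ^ t dvd ((2 ^ t) choose k) * k"
proof (cases k)
  case (Suc j)
  have "Suc (2 ^ t - 1) = (2 :: nat) ^ t"
    by simp
  then show ?thesis
    using Suc_times_binomial_eq[of "2 ^ t - 1" j] Suc by (metis dvd_triv_left)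
qed simp

lemma power2_dvd_choose_odd:
  assumes "odd k"
  shows "2 ^ t dvd ((2 ^ t) choose k)"
  using power2_dvd_choose_mult[of t k] assms by (simp add: coprime_dvd_mult_left_iff)

text \<open>The factor 2 in the lower index costs exactly one of the \<open>Suc t\<close> factors
  2.\<close>

lemma power2_dvd_choose_double_odd:
  assumes "odd k"
  shows "2 ^ t dvd ((2 ^ Suc t) choose (2 * k))"
proof -
  have "2 ^ t dvd ((2 ^ Suc t) choose (2 * k)) * k"
    using power2_dvd_choose_mult[of "Suc t" "2 * k"] by (simp add: mult.left_commute)
  then show ?thesis
    using assms by (simp add: coprime_dvd_mult_left_iff)
qed

lemma binom_power2_mult: "binom (2 ^ r * m) (2 ^ r * int q) = (2 ^ r * m) choose (2 ^ r * q)"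
proof -
  have "2 ^ r * int q = int (2 ^ r * q)"
    by simp
  then show ?thesis
    unfolding binom_def by (simp only: nat_int of_nat_less_0_iff if_False)
qed

lemma binom_power2_mult_neg:
  assumes "q < 0"
  shows "binom (2 ^ r * m) (2 ^ r * q) = 0"
  using assms by (simp add: binom_def mult_less_0_iff)

lemma binom_int: "binom m (int q) = m choose q"
  by (simp add: binom_def)

theorem proposition4p12:
  fixes r t :: nat
  assumes "r \<ge> 1" and "t \<ge> 1"
  shows "(\<forall>(m, q) \<in> {(m_seq t + 1, q_seq t), (m_seq t + 1, q_seq t - 1), (m_seq t, q_seq t - 1)}.
            (t \<noteq> 2 \<longrightarrow> [binom (2 ^ r * m) (2 ^ r * q) = 0] (mod 2 ^ (t - 1))) \<and>
            [binom (2 ^ r * m) (2 ^ r * q) = binom m q] (mod 2 ^ t)) \<and>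
         (t \<noteq> 1 \<longrightarrow> [binom (2 ^ r * m_seq t) (2 ^ r * q_seq t) = 0] (mod 2 ^ t)) \<and>
         [binom (2 ^ r * m_seq t) (2 ^ r * q_seq t) = binom (m_seq t) (q_seq t)] (mod 2 ^ (t + 1))"
proof -
  have reduce: "[binom (2 ^ r * m) (2 ^ r * int q) = 0] (mod 2 ^ s) \<and>
      [binom (2 ^ r * m) (2 ^ r * int q) = binom m (int q)] (mod 2 ^ (s + 1))"
    if "q \<le> m" and "2 ^ s dvd (m choose q)" for m q s
    using choose_power2_mult_dvd[OF that] choose_power2_mult_cong[OF that]
    unfolding binom_power2_mult binom_int cong_0_iff by blast
  consider "t = 1" | "t = 2" | "t \<ge> 3"
    using assms(2) by linarith
  then show ?thesis
  proof cases
    case 1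
    \<comment> \<open>Lower index 0 gives 1 on both sides, and index \<open>-1\<close> gives
      0.\<close>
    have "q_seq t = 0"
      using 1 by (simp add: q_seq_def)
    then show ?thesis
      using 1 binom_power2_mult_neg[of "-1" r] by (simp add: binom_def)
  next
    case 2
    \<comment> \<open>The pairs are now (5, 1), (5, 0), (4, 0), and (4, 1) for the last part; index
      0 is immediate.\<close>
    have "[binom (2 ^ r * 5) (2 ^ r) = binom 5 1] (mod 4)"
      using choose_five_cong[of r] by (simp add: binom_def nat_power_eq)
    moreover have "[binom (2 ^ r * 4) (2 ^ r) = 0] (mod 4) \<and>
        [binom (2 ^ r * 4) (2 ^ r) = binom 4 1] (mod 8)"
      using reduce[of 1 4 2] by simp
    moreover have "m_seq t = 4" "q_seq t = 1"
      using 2 by (simp_all add: m_seq_def q_seq_def)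
    ultimately show ?thesis
      using 2 by (simp add: binom_def)
  next
    case 3
    then obtain u where t: "t = u + 3"
      using le_Suc_ex by (metis add.commute)
    \<comment> \<open>With \<open>k = 2 ^ (t - 2) - 1\<close> the indices become
      \<open>2 * k + 1\<close> and \<open>2 * k\<close>; \<open>t \<ge> 3\<close> makes
      \<open>k\<close> odd.\<close>
    define k :: nat where "k = 2 ^ Suc u - 1"
    have k: "2 ^ Suc u = k + 1" and "odd k"
      by (simp_all add: k_def)
    have pow: "(2 :: nat) ^ (t - 1) = 2 * k + 2" "(2 :: nat) ^ t = 4 * k + 4"
      using k by (simp_all add: t power_add)
    have "k \<ge> 1"
      using \<open>odd k\<close> by (cases k) simp_all
    have m: "m_seq t = 2 ^ t"
      by (rule m_seq_def)
    have "q_seq t = int (2 * k + 2) - 1"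
      by (simp only: q_seq_def pow(1)[symmetric] of_nat_power of_nat_numeral)
    then have q: "q_seq t = int (2 * k + 1)" "q_seq t - 1 = int (2 * k)"
      by simp_all
    have le: "2 * k + 1 \<le> 2 ^ t" "2 * k + 1 \<le> 2 ^ t + 1" "2 * k \<le> 2 ^ t + 1" "2 * k \<le> 2 ^ t"
      by (simp_all add: pow)
    have d1: "2 ^ t dvd (2 ^ t choose (2 * k + 1))"
      by (rule power2_dvd_choose_odd) simp
    have d2: "2 ^ (t - 1) dvd (2 ^ t choose (2 * k))"
      using power2_dvd_choose_double_odd[OF \<open>odd k\<close>, of "t - 1"] assms(2) by simp
    \<comment> \<open>This index enters through Pascal's rule for
      \<open>(2 ^ t + 1) choose (2 * k)\<close>.\<close>
    have "odd (2 * k - 1)"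
      using \<open>k \<ge> 1\<close> by simp
    then have d3: "2 ^ t dvd (2 ^ t choose (2 * k - 1))"
      by (rule power2_dvd_choose_odd)
    have weaken: "2 ^ (t - 1) dvd n" if "2 ^ t dvd n" for n :: nat
      using that by (rule power_le_dvd) simp
    have d4: "2 ^ (t - 1) dvd ((2 ^ t + 1) choose (2 * k + 1))"
      using d2 weaken[OF d1] by simp
    have "(2 ^ t + 1) choose (2 * k) = (2 ^ t choose (2 * k - 1)) + (2 ^ t choose (2 * k))"
      using \<open>k \<ge> 1\<close> binomial_Suc_Suc[of "2 ^ t" "2 * k - 1"] by simp
    then have d5: "2 ^ (t - 1) dvd ((2 ^ t + 1) choose (2 * k))"
      using d2 weaken[OF d3] by simp
    have s: "t - 1 + 1 = t"
      using assms(2) by simp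
    show ?thesis
      \<comment> \<open>Here \<open>s = t\<close> serves the last part and \<open>s = t - 1\<close>
        the three pairs. Rewriting \<open>q_seq t - 1\<close> first keeps \<open>q(1)\<close> from
        breaking up that difference.\<close>
      using reduce[OF le(1) d1] reduce[OF le(2) d4] reduce[OF le(3) d5] reduce[OF le(4) d2]
      unfolding q(2) unfolding q(1) m s by (simp only: ball_simps prod.case simp_thms)
  qed
qed

end
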